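(* Let $G=(\{1,2,\dots,v\},E)$ be a simple graph with $v\ge 1$ vertices and $e=|E|\ge 0$ edges, and let $\lambda\ge 1$ be an integer. Then the number $|C^p|$ of proper $\lambda$-colorings of $G$ satisfies $$|C^p|\le \lambda^v\cdot\frac{\lambda-1}{e+\lambda-1},$$ where in the case $\lambda=1$ and $e=0$ the fraction $0/0$ is interpreted as $1$.
   Context: A $\lambda$-coloring of $G$ is any map from the vertex set $\{1,\dots,v\}$ to a fixed set $L$ of $\lambda$ colors; it is proper if no edge of $G$ has both endpoints of the same color. *)

theory Defs
  imports Complex_Main "HOL-Library.FuncSet"
begin

definition simple_graph :: "'a set \<Rightarrow> 'a set set \<Rightarrow> bool" where
  "simple_graph V E \<longleftrightarrow> (\<forall>d\<in>E. d \<subseteq> V \<and> card d = 2)"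

(* Extensional functions, so that colorings are counted as maps on V alone. *)
definition colorings :: "'a set \<Rightarrow> 'c set \<Rightarrow> ('a \<Rightarrow> 'c) set" where
  "colorings V L = V \<rightarrow>\<^sub>E L"

definition proper_coloring :: "'a set set \<Rightarrow> ('a \<Rightarrow> 'c) \<Rightarrow> bool" where
  "proper_coloring E f \<longleftrightarrow> (\<forall>x y. {x, y} \<in> E \<longrightarrow> f x \<noteq> f y)"

definition proper_colorings :: "'a set \<Rightarrow> 'a set set \<Rightarrow> 'c set \<Rightarrow> ('a \<Rightarrow> 'c) set" where
  "proper_colorings V E L = {f \<in> colorings V L. proper_coloring E f}"

(* Division by zero gives 0 in HOL, so the convention 0/0 = 1 (which applies
   exactly when l = 1 and e = 0, given l >= 1) is made explicit. *)
definition coloring_ratio :: "nat \<Rightarrow> nat \<Rightarrow> real" where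
  "coloring_ratio l e =
     (if l = 1 \<and> e = 0 then 1 else (real l - 1) / (real e + real l - 1))"

end

(* Second moment method. Let X f be the number of edges that are monochromatic under a uniformly
   random coloring f. Each edge is monochromatic with probability 1/l, and distinct edges are
   pairwise independent, because one of them has a vertex outside the other. Hence, with
   m = e + l - 1, the sum of (m - l X)^2 over all colorings is l^v m (l - 1), while every proper
   coloring (X = 0) contributes m^2 to it. *)
theory Submission
  imports Defs
begin

text \<open>Phrased for a vertex set rather than a pair, so that edges can be summed over without
  choosing endpoints.\<close>

definition monochromatic :: "'a set \<Rightarrow> ('a \<Rightarrow> 'c) \<Rightarrow> bool" where
  "monochromatic d f \<longleftrightarrow> (\<forall>x\<in>d. \<forall>y\<in>d. f x = f y)"

lemma monochromatic_fun_upd [simp]: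
  "y \<notin> d \<Longrightarrow> monochromatic d (f(y := c)) \<longleftrightarrow> monochromatic d f"
  by (auto simp: monochromatic_def)

lemma monochromatic_doubleton [simp]: "monochromatic {x, y} f \<longleftrightarrow> f y = f x"
  by (auto simp: monochromatic_def)

text \<open>Recoloring \<open>y\<close> freely turns a function with \<open>f y = f x\<close> into
  an arbitrary one satisfying \<open>P\<close>. The inverse resets \<open>y\<close> to the color of
  \<open>x\<close>, which survives since \<open>x\<close> and \<open>y\<close> differ, and remembers
  the old color of \<open>y\<close>. This is the probability 1/l of agreement at two points,
  conditioned on an event that ignores \<open>y\<close>.\<close>

lemma card_PiE_eq_at_two_points:
  assumes "x \<in> V" "y \<in> V" "x \<noteq> y"
    and inv: "\<And>f c. P (f(y := c)) \<longleftrightarrow> P f"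
  shows "card {f \<in> V \<rightarrow>\<^sub>E L. P f \<and> f y = f x} * card L = card {f \<in> V \<rightarrow>\<^sub>E L. P f}"
proof -
  let ?A = "{f \<in> V \<rightarrow>\<^sub>E L. P f \<and> f y = f x}"
  have "bij_betw (\<lambda>(f, c). f(y := c)) (?A \<times> L) {f \<in> V \<rightarrow>\<^sub>E L. P f}"
  proof (rule bij_betw_byWitness[where f' = "\<lambda>f. (f(y := f x), f y)"])
    show "(\<lambda>(f, c). f(y := c)) ` (?A \<times> L) \<subseteq> {f \<in> V \<rightarrow>\<^sub>E L. P f}"
      using assms by (auto simp: PiE_iff extensional_def)
    show "(\<lambda>f. (f(y := f x), f y)) ` {f \<in> V \<rightarrow>\<^sub>E L. P f} \<subseteq> ?A \<times> L"
      using assms by (auto simp: PiE_iff extensional_def)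
    show "\<forall>p\<in>?A \<times> L. (\<lambda>f. (f(y := f x), f y)) ((\<lambda>(f, c). f(y := c)) p) = p"
      using \<open>x \<noteq> y\<close> by (auto simp: fun_eq_iff)
  qed auto
  from bij_betw_same_card[OF this] show ?thesis
    by (simp add: card_cartesian_product)
qed

context
  fixes V :: "'a set" and E :: "'a set set" and L :: "'c set"
  assumes finV: "finite V" and graph: "simple_graph V E"
begin

lemma finite_edges: "finite E"
  by (rule finite_subset[of _ "Pow V"]) (use finV graph in \<open>auto simp: simple_graph_def\<close>)

lemma card_monochromatic_colorings:
  assumes "d \<in> E"
  shows "card {f \<in> colorings V L. monochromatic d f} * card L = card L ^ card V"
proof -
  from assms graph obtain x y where d: "d = {x, y}" "x \<noteq> y" "x \<in> V" "y \<in> V"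
    by (auto simp: simple_graph_def card_2_iff)
  show ?thesis
    using card_PiE_eq_at_two_points[of x V y "\<lambda>_. True" L] d finV
    by (simp add: colorings_def card_PiE)
qed

lemma card_two_monochromatic_colorings:
  assumes "d \<in> E" "d' \<in> E" "d \<noteq> d'"
  shows "card {f \<in> colorings V L. monochromatic d f \<and> monochromatic d' f} * (card L)\<^sup>2
           = card L ^ card V"
proof -
  have card2: "card d = 2" "card d' = 2" "d' \<subseteq> V"
    using assms graph by (auto simp: simple_graph_def)
  \<comment> \<open>Both edges have two elements, so inclusion would force equality.\<close>
  have "\<not> d' \<subseteq> d"
    using card2 \<open>d \<noteq> d'\<close> by (metis card.infinite card_subset_eq zero_neq_numeral)
  then obtain y where y: "y \<in> d'" "y \<notin> d" by blast
  with card2 obtain x where d': "d' = {x, y}" "x \<noteq> y"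
    by (auto simp: card_2_iff)
  \<comment> \<open>Recoloring \<open>y\<close> does not affect \<open>d\<close>, so
    \<open>monochromatic d\<close> can serve as the conditioning event \<open>P\<close>.\<close>
  have "card {f \<in> colorings V L. monochromatic d f \<and> monochromatic d' f} * card L
          = card {f \<in> colorings V L. monochromatic d f}"
    using card_PiE_eq_at_two_points[of x V y "monochromatic d" L] card2(3) d' y
    by (simp add: colorings_def)
  then show ?thesis
    using card_monochromatic_colorings[OF \<open>d \<in> E\<close>]
    by (simp add: power2_eq_square flip: mult.assoc)
qed

lemma proper_coloring_not_monochromatic:
  assumes "proper_coloring E f" "d \<in> E"
  shows "\<not> monochromatic d f"
proof -
  from assms(2) graph obtain x y where d: "d = {x, y}"
    by (auto simp: simple_graph_def card_2_iff)
  then have "f x \<noteq> f y" using assms by (auto simp: proper_coloring_def)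
  with d show ?thesis by simp
qed

context
  assumes finL: "finite L"
begin

text \<open>The random variable X, taken real-valued because m - l X may be negative.\<close>

definition mono_edges :: "('a \<Rightarrow> 'c) \<Rightarrow> real" where
  "mono_edges f = (\<Sum>d\<in>E. of_bool (monochromatic d f))"

lemma finite_colorings: "finite (colorings V L)"
  using finV finL by (simp add: colorings_def finite_PiE)

lemma sum_of_bool_colorings:
  "(\<Sum>f\<in>colorings V L. of_bool (P f)) = real (card {f \<in> colorings V L. P f})"
  using finite_colorings by (simp add: of_bool_def Int_def sum.If_cases)

text \<open>Linearity of expectation: exchange the sums over colorings and edges.\<close>

lemma sum_mono_edges:
  "real (card L) * (\<Sum>f\<in>colorings V L. mono_edges f) = real (card E) * real (card L) ^ card V"
proof -
  have "real (card L) * (\<Sum>f\<in>colorings V L. mono_edges f)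
      = (\<Sum>d\<in>E. real (card {f \<in> colorings V L. monochromatic d f} * card L))"
    unfolding mono_edges_def
    by (subst sum.swap) (simp add: sum_of_bool_colorings sum_distrib_left mult.commute)
  also have "\<dots> = (\<Sum>d\<in>E. real (card L) ^ card V)"
    by (intro sum.cong refl) (simp only: card_monochromatic_colorings of_nat_power)
  finally show ?thesis by simp
qed

text \<open>The square expands into ordered pairs of edges. On the diagonal the two events coincide
  and absorb only one factor \<open>card L\<close>, leaving weight \<open>card L\<close>; every
  other pair has weight 1.\<close>

lemma sum_mono_edges_squared:
  "(real (card L))\<^sup>2 * (\<Sum>f\<in>colorings V L. (mono_edges f)\<^sup>2)
     = real (card E) * (real (card L) + real (card E) - 1) * real (card L) ^ card V"
proof -
  let ?l = "real (card L)" and ?e = "real (card E)" and ?N = "real (card L) ^ card V"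
  let ?B = "\<lambda>d d'. {f \<in> colorings V L. monochromatic d f \<and> monochromatic d' f}"
  have pair: "real (card (?B d d')) * ?l\<^sup>2 = (if d' = d then ?l else 1) * ?N"
    if "d \<in> E" "d' \<in> E" for d d'
  proof (cases "d' = d")
    case True
    have "real (card (?B d d)) * ?l = ?N"
      using card_monochromatic_colorings[OF \<open>d \<in> E\<close>]
      by (simp flip: of_nat_mult of_nat_power)
    with True show ?thesis by (simp add: power2_eq_square)
  next
    case False
    have "real (card (?B d d')) * ?l\<^sup>2 = ?N"
      using card_two_monochromatic_colorings[OF that] False by (simp flip: of_nat_mult of_nat_power)
    with False show ?thesis by simp
  qed
  have "?l\<^sup>2 * (\<Sum>f\<in>colorings V L. (mono_edges f)\<^sup>2)
      = ?l\<^sup>2 * (\<Sum>f\<in>colorings V L. \<Sum>d\<in>E. \<Sum>d'\<in>E. of_bool (monochromatic d f \<and> monochromatic d' f))"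
    by (simp add: mono_edges_def power2_eq_square sum_product of_bool_conj)
  also have "\<dots> = ?l\<^sup>2 * (\<Sum>d\<in>E. \<Sum>d'\<in>E. real (card (?B d d')))"
    unfolding sum_of_bool_colorings[symmetric]
    by (subst sum.swap) (simp only: sum.swap[of _ E "colorings V L"])
  also have "\<dots> = (\<Sum>d\<in>E. \<Sum>d'\<in>E. (if d' = d then ?l else 1) * ?N)"
    unfolding sum_distrib_left
    by (intro sum.cong refl) (simp only: pair mult.commute[of "?l\<^sup>2"])
  \<comment> \<open>Weight 1 everywhere plus an excess \<open>?l - 1\<close> on the diagonal: each
    row then sums to \<open>?e + ?l - 1\<close>.\<close>
  also have "\<dots> = (\<Sum>d\<in>E. (\<Sum>d'\<in>E. 1 + (if d' = d then ?l - 1 else 0)) * ?N)"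
    by (intro sum.cong refl) (auto simp: sum_distrib_right intro!: sum.cong)
  also have "\<dots> = (\<Sum>d\<in>E. (?e + ?l - 1) * ?N)"
    using finite_edges by (intro sum.cong refl) (simp add: sum.distrib)
  finally show ?thesis by (simp add: algebra_simps)
qed

lemma card_proper_colorings_mult_le:
  assumes "card L \<ge> 1"
  shows "real (card (proper_colorings V E L)) * (real (card E) + real (card L) - 1)
           \<le> real (card L) ^ card V * (real (card L) - 1)"
proof -
  let ?l = "real (card L)" and ?e = "real (card E)" and ?N = "real (card L) ^ card V"
  \<comment> \<open>With t > 0 in place of \<open>m\<close>, the argument bounds the proportion of
    proper colorings by 1 - 2e/t + e(e + l - 1)/t^2; for e > 0 this is least at t = e + l -
    1.\<close>
  define m where "m = ?e + ?l - 1"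
  have "real (card (proper_colorings V E L)) * m\<^sup>2
      = (\<Sum>f\<in>proper_colorings V E L. (m - ?l * mono_edges f)\<^sup>2)"
    by (simp add: mono_edges_def proper_colorings_def proper_coloring_not_monochromatic)
  also have "\<dots> \<le> (\<Sum>f\<in>colorings V L. (m - ?l * mono_edges f)\<^sup>2)"
    by (rule sum_mono2[OF finite_colorings]) (auto simp: proper_colorings_def)
  also have "\<dots> = (\<Sum>f\<in>colorings V L. m\<^sup>2) - 2 * m * (?l * (\<Sum>f\<in>colorings V L. mono_edges f))
      + ?l\<^sup>2 * (\<Sum>f\<in>colorings V L. (mono_edges f)\<^sup>2)"
    unfolding sum_distrib_left sum_subtractf[symmetric] sum.distrib[symmetric]
    by (intro sum.cong refl) (simp add: power2_eq_square algebra_simps)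
  also have "\<dots> = ?N * m\<^sup>2 - 2 * m * (?e * ?N) + ?e * m * ?N"
    unfolding sum_mono_edges sum_mono_edges_squared
    using finV by (simp add: m_def colorings_def card_PiE algebra_simps)
  also have "\<dots> = (?N * (?l - 1)) * m"
    by (simp add: m_def power2_eq_square algebra_simps)
  finally have "(real (card (proper_colorings V E L)) * m) * m \<le> (?N * (?l - 1)) * m"
    by (simp add: power2_eq_square mult.assoc)
  moreover have "m \<ge> 0" using assms by (simp add: m_def)
  \<comment> \<open>One factor \<open>m\<close> cancels if it is positive. If \<open>m = 0\<close>,
    the left side vanishes and the right side is nonnegative because \<open>card L\<close> is at
    least 1.\<close>
  ultimately show ?thesis
    using assms by (cases "m = 0") (auto simp: m_def)
qed

end

end

theorem mainTheorem1:
  fixes v e l :: nat and E :: "nat set set" and L :: "'c set"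
  assumes "v \<ge> 1"
    and "simple_graph {1..v} E"
    and "e = card E"
    and "l \<ge> 1"
    and "finite L" and "card L = l"
  shows "real (card (proper_colorings {1..v} E L)) \<le> real l ^ v * coloring_ratio l e"
proof (cases "l = 1 \<and> e = 0")
  case True
  \<comment> \<open>Here the product form of the bound only says 0 \<le> 0, so the trivial bound by
    the number of all colorings is used.\<close>
  have "card (proper_colorings {1..v} E L) \<le> card (colorings {1..v} L)"
    using assms by (intro card_mono finite_colorings) (auto simp: proper_colorings_def)
  also have "\<dots> = l ^ v"
    using assms by (simp add: colorings_def card_PiE)
  finally show ?thesis
    using True by (simp add: coloring_ratio_def)
next
  case False
  then have "real e + real l - 1 > 0"
    using assms(4) by auto
  moreover have "real (card (proper_colorings {1..v} E L)) * (real e + real l - 1)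
      \<le> real l ^ v * (real l - 1)"
    using card_proper_colorings_mult_le[of "{1..v}" E L] assms by simp
  ultimately show ?thesis
    using False by (simp add: coloring_ratio_def pos_le_divide_eq)
qed

end
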